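(* Assume $\rho(\partial_0 f)<1$, and let $\tilde p$, $\tilde R$, $D_a(0)$ and $N_p^c$ be as defined in the context. Let $p\geq\tilde p$ be an integer. For any $c\in(0,(p+1)\tilde R^2]$, the set $N_p^c$ is included in the domain of attraction $D_a(0)$.
   Context: Let $\Omega\subset\mathbb{R}^n$ be a domain (open connected set) with $0\in\Omega$, and let $f:\Omega\to\Omega$ be an $\mathbb{R}$-analytic function with $f(0)=0$. Write $f^k$ for the $k$-th iterate of $f$ ($f^0=\mathrm{id}$), $\|\cdot\|$ for the Euclidean norm on $\mathbb{R}^n$ and for the induced operator norm on matrices, $A=\partial_0 f$ for the Jacobian matrix of $f$ at $0$, $\rho(A)$ for its spectral radius, and $B(r)=\{x\in\mathbb{R}^n:\|x\|<r\}$ for $r>0$. The domain of attraction of $0$ is $D_a(0)=\{x\in\Omega: f^k(x)\to 0 \text{ as } k\to\infty\}$. Standing assumption: $\rho(A)<1$. Let $\tilde p\geq 1$ be the smallest positive integer such that $\|A^p\|<1$ for any $p\geq\tilde p$. Let $\tilde R>0$ be the largest number such that $B(\tilde R)\subset\Omega$ and $\|f^p(x)\|<\|x\|$ for all $p\in\{\tilde p,\tilde p+1,\dots,2\tilde p-1\}$ and $x\in B(\tilde R)\setminus\{0\}$ (some positive radius with this property exists); if every $r>0$ has this property, then $\tilde R=+\infty$ and $B(\tilde R)=\Omega=\mathbb{R}^n$. For an integer $p\ge 0$ and $x\in\Omega$ put $V_p(x)=\sum_{k=0}^{p}\|f^k(x)\|^2$. For $p\geq 0$ and $c>0$ put $N_p^c=\{x\in\Omega: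 V_p(x)<c\}$, with $N_p^c=\Omega$ if $c=+\infty$. *)

theory Defs
  imports "HOL-Analysis.Analysis"
begin

text \<open>
  Multi-indices are functions \<open>'n \<Rightarrow> nat\<close>. In finite dimension, \<open>has_sum\<close> over all of them is
  absolute convergence of the power series, so no order of summation has to be chosen.
  The condition \<open>ball a r \<subseteq> S\<close> is no restriction on an open set, and makes the notion
  independent of the values of \<open>f\<close> outside \<open>S\<close>.
\<close>
definition real_analytic_on :: "(real ^ 'n \<Rightarrow> real ^ 'm) \<Rightarrow> (real ^ 'n) set \<Rightarrow> bool" where
  "real_analytic_on f S \<longleftrightarrow>
     (\<forall>a\<in>S. \<exists>r>0. \<exists>c :: ('n \<Rightarrow> nat) \<Rightarrow> real ^ 'm. ball a r \<subseteq> S \<and>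
        (\<forall>x\<in>ball a r. ((\<lambda>\<alpha>. (\<Prod>i\<in>UNIV. (x $ i - a $ i) ^ \<alpha> i) *\<^sub>R c \<alpha>) has_sum f x) UNIV))"

text \<open>Matrix powers have to be defined: \<open>(^)\<close> on the type \<open>real ^ 'n ^ 'n\<close> is entrywise.\<close>
primrec mat_pow :: "real ^ 'n ^ 'n \<Rightarrow> nat \<Rightarrow> real ^ 'n ^ 'n" where
  "mat_pow A 0 = mat 1"
| "mat_pow A (Suc k) = A ** mat_pow A k"

definition mat_norm :: "real ^ 'n ^ 'm \<Rightarrow> real" where
  "mat_norm A = onorm ((*v) A)"

definition complex_spectrum :: "real ^ 'n ^ 'n \<Rightarrow> complex set" where
  "complex_spectrum A = {l. \<exists>v. v \<noteq> 0 \<and> map_matrix complex_of_real A *v v = l *s v}"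

definition mat_spectral_radius :: "real ^ 'n ^ 'n \<Rightarrow> real" where
  "mat_spectral_radius A = Max (norm ` complex_spectrum A)"

definition attraction_domain :: "(real ^ 'n \<Rightarrow> real ^ 'n) \<Rightarrow> (real ^ 'n) set \<Rightarrow> (real ^ 'n) set" where
  "attraction_domain f \<Omega> = {x \<in> \<Omega>. (\<lambda>k. (f ^^ k) x) \<longlonglongrightarrow> 0}"

definition p_tilde :: "(real ^ 'n \<Rightarrow> real ^ 'n) \<Rightarrow> nat" where
  "p_tilde f = (LEAST q. 1 \<le> q \<and> (\<forall>p\<ge>q. mat_norm (mat_pow (jacobian f (at 0)) p) < 1))"

text \<open>Radii are extended reals, so that \<open>eball0 \<infinity>\<close> is the whole space.\<close>
definition eball0 :: "ereal \<Rightarrow> (real ^ 'n) set" where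
  "eball0 r = {x. ereal (norm x) < r}"

text \<open>
  The largest admissible radius is taken among the extended reals; the radius \<open>\<infinity>\<close> is
  admissible exactly if every real \<open>r > 0\<close> is.
\<close>
definition R_tilde :: "(real ^ 'n \<Rightarrow> real ^ 'n) \<Rightarrow> (real ^ 'n) set \<Rightarrow> ereal" where
  "R_tilde f \<Omega> = (GREATEST r. 0 < r \<and> eball0 r \<subseteq> \<Omega> \<and>
     (\<forall>p\<in>{p_tilde f..2 * p_tilde f - 1}. \<forall>x\<in>eball0 r - {0}. norm ((f ^^ p) x) < norm x))"

definition V_sum :: "(real ^ 'n \<Rightarrow> real ^ 'n) \<Rightarrow> nat \<Rightarrow> real ^ 'n \<Rightarrow> real" where
  "V_sum f p x = (\<Sum>k=0..p. (norm ((f ^^ k) x))\<^sup>2)"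

text \<open>For \<open>c = \<infinity>\<close> the inequality is void and the set is \<open>\<Omega>\<close>.\<close>
definition N_set :: "(real ^ 'n \<Rightarrow> real ^ 'n) \<Rightarrow> (real ^ 'n) set \<Rightarrow> nat \<Rightarrow> ereal \<Rightarrow> (real ^ 'n) set" where
  "N_set f \<Omega> p c = {x \<in> \<Omega>. ereal (V_sum f p x) < c}"

end

theory Submission
  imports Defs "HOL-Computational_Algebra.Fundamental_Theorem_Algebra"
begin

text \<open>
  Write \<open>R\<close> for \<open>R_tilde f \<Omega>\<close> and \<open>q\<close> for \<open>p_tilde f\<close>. If all of the \<open>p + 1\<close> terms of \<open>V_sum f p x\<close>
  were at least \<open>R\<^sup>2\<close>, then \<open>V_sum f p x\<close> could not be less than \<open>c \<le> (p + 1) R\<^sup>2\<close>. Hence the orbit of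
  a point of \<open>N_set f \<Omega> p c\<close> enters \<open>eball0 R\<close>
  (\<open>V_sum_less_imp_iterate_in_eball0\<close>), and it is enough that every point \<open>y\<close> of this ball is
  attracted to 0 (\<open>eball0_admissible_attracted\<close>). There \<open>g = f ^^ q\<close> strictly decreases the norm of
  every nonzero point, so the \<open>g\<close>-orbit of \<open>y\<close> stays in a compact ball on which \<open>g\<close> is continuous,
  and the norms along it decrease to some \<open>L\<close>. A limit point \<open>z\<close> satisfies \<open>norm z = norm (g z) = L\<close>,
  which forces \<open>z = 0\<close> and \<open>L = 0\<close>. The full \<open>f\<close>-orbit consists of the images of the \<open>g\<close>-orbit under
  the finitely many maps \<open>f ^^ j\<close>, \<open>j < q\<close>, which are continuous and fix 0; so it converges as well.

  What takes work is that \<open>q\<close> and \<open>R\<close>, defined as a least number and as a greatest radius, exist and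
  so have their defining properties. For \<open>q\<close> this means that the powers of a matrix \<open>A\<close> with spectral
  radius less than 1 tend to 0 (\<open>mat_norm_pow_tendsto_0\<close>). The powers of a complex
  matrix are linearly dependent, so some nonzero polynomial \<open>p\<close> annihilates it; splitting off the roots of \<open>p\<close> one by one reduces the convergence of
  the orbit of a vector to scalar recurrences with ratio \<open>l\<close>, where \<open>l\<close> is an eigenvalue. The same
  polynomial shows that the spectrum is finite, so that the maximum in the definition of the
  spectral radius bounds every eigenvalue.

  For \<open>R\<close>, the supremum of all admissible radii is admissible because the open ball with that radius
  is the union of the smaller admissible ones (\<open>admissible_radius_R_tilde\<close>), and some radius is
  admissible because \<open>f ^^ k\<close> has at 0 the derivative \<open>A ^ k\<close>, of norm less than 1 if \<open>k \<ge> q\<close>. This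
  requires the power series of \<open>f\<close> to be differentiable at the centre of expansion
  (\<open>real_analytic_on_differentiable\<close>), which gives the continuity of \<open>f\<close> on \<open>\<Omega>\<close> too.
\<close>

section \<open>Powers of a matrix of spectral radius less than 1\<close>

text \<open>
  The value at \<open>x\<close> of the operator \<open>p(B)\<close>, by Horner's rule: recursion on \<open>pCons\<close> then matches
  induction on polynomials.
\<close>
definition poly_action :: "complex ^ 'n ^ 'n \<Rightarrow> complex poly \<Rightarrow> complex ^ 'n \<Rightarrow> complex ^ 'n" where
  "poly_action B p x = fold_coeffs (\<lambda>a y. a *s x + B *v y) p 0"

lemma poly_action_0 [simp]: "poly_action B 0 x = 0"
  by (simp add: poly_action_def)

lemma poly_action_pCons [simp]:
  "poly_action B (pCons a p) x = a *s x + B *v poly_action B p x"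
  by (cases "p = 0 \<and> a = 0") (auto simp: poly_action_def)

lemma poly_action_add: "poly_action B (p + q) x = poly_action B p x + poly_action B q x"
  by (induction p q rule: poly_induct2)
    (simp_all add: matrix_vector_right_distrib vector_sadd_rdistrib)

lemma poly_action_smult: "poly_action B (smult c p) x = c *s poly_action B p x"
  by (induction p)
    (simp_all add: vector_add_ldistrib vector_smult_assoc vector_scalar_commute)

lemma poly_action_sum: "poly_action B (sum q I) x = (\<Sum>i\<in>I. poly_action B (q i) x)"
  by (induction I rule: infinite_finite_induct) (simp_all add: poly_action_add)

lemma poly_action_monom: "poly_action B (monom c k) x = c *s ((*v) B ^^ k) x"
  by (induction k) (simp_all add: monom_0 monom_Suc vector_scalar_commute)

lemma poly_action_diff_right: "poly_action B p (x - y) = poly_action B p x - poly_action B p y"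
  by (induction p)
    (simp_all add: matrix_vector_mult_diff_distrib vector_ssub_ldistrib add_diff_add)

lemma poly_action_scale_right: "poly_action B p (c *s x) = c *s poly_action B p x"
  by (induction p)
    (simp_all add: vector_add_ldistrib vector_smult_assoc vector_scalar_commute mult.commute)

lemma poly_action_mult_vec: "poly_action B p (B *v x) = B *v poly_action B p x"
  by (induction p) (simp_all add: matrix_vector_right_distrib vector_scalar_commute)

text \<open>
  The factor \<open>B - l\<close> of \<open>p(B)\<close> can be applied last or first. In the first form \<open>p(B) x = 0\<close> says that
  \<open>q(B) x\<close> is an eigenvector or 0, in the second that \<open>q\<close> annihilates \<open>B x - l x\<close>.
\<close>
lemma poly_action_linear_factor:
  "poly_action B ([:- l, 1:] * q) x = B *v poly_action B q x - l *s poly_action B q x"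
  "poly_action B ([:- l, 1:] * q) x = poly_action B q (B *v x - l *s x)"
proof -
  show *: "poly_action B ([:- l, 1:] * q) x = B *v poly_action B q x - l *s poly_action B q x"
  proof -
    have "[:- l, 1:] * q = pCons 0 q + smult (- l) q" by simp
    then show ?thesis by (simp only: poly_action_add poly_action_smult) (simp add: vec_eq_iff)
  qed
  show "poly_action B ([:- l, 1:] * q) x = poly_action B q (B *v x - l *s x)"
    unfolding * by (simp add: poly_action_diff_right poly_action_mult_vec poly_action_scale_right)
qed

lemma poly_action_eigenvector:
  assumes "B *v v = l *s v"
  shows "poly_action B p v = poly p l *s v"
  by (induction p)
    (simp_all add: assms vector_scalar_commute vector_smult_assoc vector_sadd_rdistrib mult.commute)

text \<open>
  The members of the sequence may repeat, so dependence of their set is not the same as a relation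
  between the indexed terms; a repetition gives a relation with coefficients 1 and -1.
\<close>
lemma nontrivial_linear_relation:
  fixes g :: "nat \<Rightarrow> 'a :: euclidean_space"
  obtains u N where "\<exists>i\<le>N. u i \<noteq> 0" "(\<Sum>i\<le>N. u i *\<^sub>R g i) = 0"
proof (cases "inj_on g {..DIM('a)}")
  case True
  then have "card (g ` {..DIM('a)}) > DIM('a)"
    by (simp add: card_image)
  then have "dependent (g ` {..DIM('a)})"
    using independent_bound by fastforce
  then obtain u where "\<exists>v\<in>g ` {..DIM('a)}. u v \<noteq> 0" "(\<Sum>v\<in>g ` {..DIM('a)}. u v *\<^sub>R v) = 0"
    by (subst (asm) real_vector.dependent_finite) auto
  with True show ?thesis
    by (intro that[of "DIM('a)" "u \<circ> g"]) (auto simp: sum.reindex)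
next
  case False
  then obtain i j where ij: "i \<le> DIM('a)" "j \<le> DIM('a)" "i \<noteq> j" "g i = g j"
    by (auto simp: inj_on_def)
  let ?u = "\<lambda>k. if k = i then 1 else if k = j then -1 else 0 :: real"
  have "(\<Sum>k\<le>DIM('a). ?u k *\<^sub>R g k) = (\<Sum>k\<in>{i, j}. ?u k *\<^sub>R g k)"
    using ij by (intro sum.mono_neutral_right) auto
  also have "\<dots> = 0" using ij by simp
  finally show ?thesis using ij by (intro that[of "DIM('a)" ?u]) auto
qed

text \<open>
  Square matrices form a space of finite dimension over the reals, so the powers of \<open>B\<close> satisfy a
  linear relation, whose coefficients are those of \<open>p\<close>.
\<close>
lemma annihilating_polynomial:
  fixes B :: "complex ^ 'n ^ 'n"
  obtains p where "p \<noteq> 0" "\<And>x. poly_action B p x = 0"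
proof -
  define M where "M i = ((**) B ^^ i) (mat 1)" for i
  have M: "M i *v x = ((*v) B ^^ i) x" for i x
    by (induction i) (simp_all add: M_def flip: matrix_vector_mul_assoc)
  obtain u N where u: "\<exists>i\<le>N. u i \<noteq> 0" "(\<Sum>i\<le>N. u i *\<^sub>R M i) = 0"
    by (rule nontrivial_linear_relation)
  define p where "p = (\<Sum>i\<le>N. monom (complex_of_real (u i)) i)"
  obtain i where i: "i \<le> N" "u i \<noteq> 0" using u by blast
  have "coeff p i = (\<Sum>j\<le>N. if j = i then complex_of_real (u j) else 0)"
    unfolding p_def by (simp add: coeff_sum coeff_monom)
  also have "\<dots> = u i" using i by (simp add: sum.delta')
  finally have "p \<noteq> 0" using i by auto
  moreover have "poly_action B p x = 0" for x
  proof -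
    have "poly_action B p x = (\<Sum>i\<le>N. complex_of_real (u i) *s (M i *v x))"
      by (simp add: p_def poly_action_sum poly_action_monom M)
    also have "\<dots> = (\<Sum>i\<le>N. u i *\<^sub>R M i) *v x"
    proof -
      have "(\<Sum>i\<in>I. complex_of_real (u i) *s (M i *v x)) = (\<Sum>i\<in>I. u i *\<^sub>R M i) *v x"
        if "finite I" for I
        using that
      proof induction
        case (insert k I)
        have "(u k *\<^sub>R M k) *v x = complex_of_real (u k) *s (M k *v x)"
          unfolding vec_eq_iff matrix_vector_mult_def
          by (simp add: sum_distrib_left scaleR_conv_of_real[where 'a = complex] mult.assoc)
        with insert show ?case by (simp add: matrix_vector_mult_add_rdistrib)
      qed simp
      then show ?thesis by simp
    qed
    finally show ?thesis by (simp add: u)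
  qed
  ultimately show ?thesis using that by blast
qed

text \<open>
  Once \<open>b k \<le> e (1 - q) / 2\<close>, the affine map \<open>t \<mapsto> q t + e (1 - q) / 2\<close> dominates the recurrence.
  Its fixed point is \<open>e / 2\<close>, and the distance from it shrinks by the factor \<open>q\<close> in each step.
\<close>
lemma affine_recurrence_tendsto_0:
  fixes a b :: "nat \<Rightarrow> real"
  assumes q: "0 \<le> q" "q < 1" and a: "\<And>k. 0 \<le> a k" "\<And>k. a (Suc k) \<le> q * a k + b k"
    and b: "b \<longlonglongrightarrow> 0"
  shows "a \<longlonglongrightarrow> 0"
proof (rule LIMSEQ_I)
  fix e :: real assume e: "e > 0"
  then have "e * (1 - q) / 2 > 0" using q by simp
  from LIMSEQ_D[OF b this] obtain N where N: "\<And>k. k \<ge> N \<Longrightarrow> norm (b k - 0) < e * (1 - q) / 2"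
    by blast
  have bound: "a (N + m) \<le> q ^ m * a N + e / 2" for m
  proof (induction m)
    case (Suc m)
    have "a (N + Suc m) \<le> q * a (N + m) + e * (1 - q) / 2"
      using a(2)[of "N + m"] N[of "N + m"] by auto
    also have "\<dots> \<le> q * (q ^ m * a N + e / 2) + e * (1 - q) / 2"
      using Suc q by (intro add_right_mono mult_left_mono)
    finally show ?case by (simp add: field_simps)
  qed (use e in simp)
  have "(\<lambda>m. q ^ m * a N) \<longlonglongrightarrow> 0 * a N"
    using q by (intro tendsto_intros) auto
  from LIMSEQ_D[OF this, of "e / 2"] e obtain K where K: "\<And>m. m \<ge> K \<Longrightarrow> \<bar>q ^ m * a N\<bar> < e / 2"
    by auto
  show "\<exists>no. \<forall>n\<ge>no. norm (a n - 0) < e"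
  proof (intro exI allI impI)
    fix n assume "n \<ge> N + K"
    then have "n = N + (n - N)" "n - N \<ge> K" by auto
    then show "norm (a n - 0) < e" using bound[of "n - N"] K[of "n - N"] a(1)[of n] by auto
  qed
qed

lemma norm_smult_complex_vec: "norm (c *s (x :: complex ^ 'n)) = norm c * norm x"
  by (simp add: norm_vec_def norm_mult L2_set_right_distrib)

text \<open>
  Induction on the degree of \<open>p = (X - l) q\<close>. If \<open>q(B) x = 0\<close>, the root \<open>l\<close> can be discarded. Otherwise
  \<open>q(B) x\<close> is an eigenvector for \<open>l\<close>, so \<open>norm l < 1\<close>; the vector \<open>w = B x - l x\<close> is annihilated by \<open>q\<close>,
  and the orbit of \<open>x\<close> satisfies an affine recurrence with ratio \<open>l\<close> and inhomogeneity \<open>B ^ k w\<close>,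
  which tends to 0 by induction.
\<close>
lemma iterates_tendsto_0_if_annihilated:
  fixes B :: "complex ^ 'n ^ 'n"
  assumes spec: "\<And>l v. v \<noteq> 0 \<Longrightarrow> B *v v = l *s v \<Longrightarrow> norm l < 1"
    and "p \<noteq> 0" "poly_action B p x = 0"
  shows "(\<lambda>k. ((*v) B ^^ k) x) \<longlonglongrightarrow> 0"
  using assms(2,3)
proof (induction "degree p" arbitrary: p x)
  case 0
  then obtain a where "p = [:a:]" by (metis degree_eq_zeroE)
  with 0 have "x = 0" by (auto simp: vec_eq_iff)
  moreover have "((*v) B ^^ k) 0 = 0" for k by (induction k) auto
  ultimately show ?case by simp
next
  case (Suc d)
  then have "\<not> constant (poly p)" by (simp add: constant_degree)
  then obtain l where "poly p l = 0" using fundamental_theorem_of_algebra by blast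
  then obtain q where q: "p = [:- l, 1:] * q" by (auto simp: poly_eq_0_iff_dvd elim: dvdE)
  with Suc have "q \<noteq> 0" by auto
  then have d: "d = degree q" using Suc.hyps(2) degree_mult_eq[of "[:- l, 1:]" q] q by simp
  show ?case
  proof (cases "poly_action B q x = 0")
    case True
    then show ?thesis using Suc.hyps(1)[OF d \<open>q \<noteq> 0\<close>] by blast
  next
    case False
    have "B *v poly_action B q x = l *s poly_action B q x"
      using Suc.prems(2) by (simp only: q poly_action_linear_factor(1)) simp
    then have l: "norm l < 1" using spec False by blast
    define w where "w = B *v x - l *s x"
    have "poly_action B q w = 0"
      using Suc.prems(2) by (simp only: q poly_action_linear_factor(2) w_def)
    then have w: "(\<lambda>k. ((*v) B ^^ k) w) \<longlonglongrightarrow> 0" using Suc.hyps(1)[OF d \<open>q \<noteq> 0\<close>] by blast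
    have "((*v) B ^^ Suc k) x = l *s ((*v) B ^^ k) x + ((*v) B ^^ k) w" for k
    proof -
      have "((*v) B ^^ k) (B *v x - l *s x) = B *v ((*v) B ^^ k) x - l *s ((*v) B ^^ k) x"
        by (induction k) (simp_all add: matrix_vector_mult_diff_distrib vector_scalar_commute)
      then show ?thesis by (simp add: w_def)
    qed
    then have "norm (((*v) B ^^ Suc k) x) \<le> norm l * norm (((*v) B ^^ k) x) + norm (((*v) B ^^ k) w)" for k
      by (metis norm_smult_complex_vec norm_triangle_ineq)
    from affine_recurrence_tendsto_0[OF _ l _ this tendsto_norm_zero[OF w]]
    show ?thesis by (simp add: tendsto_norm_zero_iff)
  qed
qed

text \<open>
  Every eigenvalue is a root of an annihilating polynomial.
\<close>
lemma finite_complex_spectrum: "finite (complex_spectrum A)"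
proof -
  obtain p where p: "p \<noteq> 0" "\<And>x. poly_action (map_matrix complex_of_real A) p x = 0"
    using annihilating_polynomial by blast
  have "complex_spectrum A \<subseteq> {l. poly p l = 0}"
    using p(2) by (auto simp: complex_spectrum_def) (metis poly_action_eigenvector vector_mul_eq_0)
  then show ?thesis using poly_roots_finite[OF p(1)] finite_subset by blast
qed

lemma mat_pow_mult_vec: "mat_pow A k *v x = ((*v) A ^^ k) x"
  by (induction k) (simp_all flip: matrix_vector_mul_assoc)

lemma mat_pow_mult_vec_tendsto_0:
  fixes A :: "real ^ 'n ^ 'n"
  assumes "mat_spectral_radius A < 1"
  shows "(\<lambda>k. mat_pow A k *v x) \<longlonglongrightarrow> 0"
proof -
  define B where "B = map_matrix complex_of_real A"
  define cv where "cv y = (\<chi> i. complex_of_real (y $ i))" for y :: "real ^ 'n"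
  have spec: "norm l < 1" if "v \<noteq> 0" "B *v v = l *s v" for l v
  proof -
    have "l \<in> complex_spectrum A" using that by (auto simp: complex_spectrum_def B_def)
    then have "norm l \<le> mat_spectral_radius A"
      unfolding mat_spectral_radius_def by (intro Max_ge finite_imageI finite_complex_spectrum imageI)
    then show ?thesis using assms by simp
  qed
  have B: "((*v) B ^^ k) (cv x) = cv (mat_pow A k *v x)" for k
  proof (induction k)
    case (Suc k)
    have "B *v cv y = cv (A *v y)" for y
      by (simp add: vec_eq_iff B_def cv_def matrix_vector_mult_def map_matrix_def)
    with Suc show ?case by (simp flip: matrix_vector_mul_assoc)
  qed simp
  obtain p where "p \<noteq> 0" "\<And>x. poly_action B p x = 0"
    using annihilating_polynomial by blast
  then have "(\<lambda>k. cv (mat_pow A k *v x)) \<longlonglongrightarrow> 0"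
    using iterates_tendsto_0_if_annihilated[of B p "cv x"] spec B by auto
  from tendsto_Re[OF tendsto_vec_nth[OF this]]
  have "(\<lambda>k. (mat_pow A k *v x) $ i) \<longlonglongrightarrow> 0" for i
    by (simp add: cv_def)
  then show ?thesis by (intro vec_tendstoI) simp
qed

lemma mat_norm_pow_tendsto_0:
  fixes A :: "real ^ 'n ^ 'n"
  assumes "mat_spectral_radius A < 1"
  shows "(\<lambda>k. mat_norm (mat_pow A k)) \<longlonglongrightarrow> 0"
proof (rule tendsto_sandwich[OF _ _ tendsto_const])
  show "\<forall>\<^sub>F k in sequentially. 0 \<le> mat_norm (mat_pow A k)"
    by (simp add: mat_norm_def onorm_pos_le)
  show "\<forall>\<^sub>F k in sequentially. mat_norm (mat_pow A k) \<le> (\<Sum>i\<in>UNIV. \<Sum>j\<in>UNIV. \<bar>mat_pow A k $ i $ j\<bar>)"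
    by (simp add: mat_norm_def onorm_le_matrix_component_sum)
  have "mat_pow A k $ i $ j = (mat_pow A k *v axis j 1) $ i" for k i j
    by (simp add: matrix_vector_mult_basis column_def)
  moreover have "(\<lambda>k. (mat_pow A k *v axis j 1) $ i) \<longlonglongrightarrow> 0" for i j
    using tendsto_vec_nth[OF mat_pow_mult_vec_tendsto_0[OF assms]] by simp
  ultimately have "(\<lambda>k. mat_pow A k $ i $ j) \<longlonglongrightarrow> 0" for i j by simp
  then show "(\<lambda>k. \<Sum>i\<in>UNIV. \<Sum>j\<in>UNIV. \<bar>mat_pow A k $ i $ j\<bar>) \<longlonglongrightarrow> 0"
    by (intro tendsto_null_sum tendsto_rabs_zero)
qed

section \<open>Differentiability of power series in several variables\<close>

text \<open>
  The exponent of the monomial \<open>x $ i\<close>.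
\<close>
definition unit_index :: "'n \<Rightarrow> 'n \<Rightarrow> nat" where
  "unit_index i = (\<lambda>j. if j = i then 1 else 0)"

lemma inj_unit_index: "inj unit_index"
  by (rule injI) (metis unit_index_def zero_neq_one)

lemma sum_multiindex_ge_2:
  fixes \<alpha> :: "'n :: finite \<Rightarrow> nat"
  assumes "\<alpha> \<notin> insert (\<lambda>_. 0) (range unit_index)"
  shows "2 \<le> sum \<alpha> UNIV"
proof (rule ccontr)
  assume "\<not> 2 \<le> sum \<alpha> UNIV"
  moreover have "sum \<alpha> UNIV \<noteq> 0" using assms by auto
  ultimately have "sum \<alpha> UNIV = 1" by linarith
  then obtain i where "\<alpha> i = 1" "\<forall>j. j \<noteq> i \<longrightarrow> \<alpha> j = 0"
    using sum_eq_1_iff[of UNIV \<alpha>] by auto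
  then have "\<alpha> = unit_index i" by (auto simp: unit_index_def)
  with assms show False by blast
qed

text \<open>
  The series converges absolutely at the vector with all entries \<open>s\<close>, that is, the sum of the
  \<open>G \<alpha> = s ^ \<bar>\<alpha>\<bar> * norm (c \<alpha>)\<close> is finite. If \<open>norm h = t * s\<close> with \<open>t \<le> 1\<close>, the term at \<open>\<alpha>\<close> has norm at
  most \<open>t ^ \<bar>\<alpha>\<bar> * G \<alpha>\<close>, hence at most \<open>t\<^sup>2 * G \<alpha>\<close> if \<open>\<bar>\<alpha>\<bar> \<ge> 2\<close>. So all terms of order at least 2 together
  are quadratically small.
\<close>
lemma power_series_first_order:
  fixes g :: "real ^ 'n \<Rightarrow> real ^ 'm" and c :: "('n \<Rightarrow> nat) \<Rightarrow> real ^ 'm"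
  assumes "r > 0"
    and g: "\<And>h. h \<in> ball 0 r \<Longrightarrow> ((\<lambda>\<alpha>. (\<Prod>i\<in>UNIV. (h $ i) ^ \<alpha> i) *\<^sub>R c \<alpha>) has_sum g h) UNIV"
  obtains s K where "s > 0" "0 \<le> K"
    "\<And>h. norm h \<le> s \<Longrightarrow>
      norm (g h - c (\<lambda>_. 0) - (\<Sum>i\<in>UNIV. h $ i *\<^sub>R c (unit_index i))) \<le> K * (norm h)\<^sup>2"
proof -
  \<comment> \<open>with this \<open>s\<close> the 1-norm of the vector with all entries \<open>s\<close> is \<open>r / 2\<close>\<close>
  define s where "s = r / (2 * real CARD('n))"
  have card: "real CARD('n) \<ge> 1" by (simp add: Suc_le_eq)
  have s: "s > 0" using \<open>r > 0\<close> by (simp add: s_def)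
  have "norm (\<chi> i :: 'n. s) \<le> (\<Sum>i\<in>(UNIV :: 'n set). \<bar>s\<bar>)"
    using norm_le_l1_cart[of "\<chi> i :: 'n. s"] by simp
  also have "\<dots> = r / 2" using \<open>r > 0\<close> by (simp add: s_def)
  finally have "norm (\<chi> i :: 'n. s) < r" using \<open>r > 0\<close> by simp
  moreover have "s \<le> r / 2"
    unfolding s_def using card \<open>r > 0\<close> by (intro divide_left_mono) auto
  ultimately have "s < r" and vs: "(\<chi> i :: 'n. s) \<in> ball 0 r" using \<open>r > 0\<close> by auto
  define F where "F = insert (\<lambda>_. 0) (range (unit_index :: 'n \<Rightarrow> _))"
  define G where "G \<alpha> = s ^ sum \<alpha> UNIV * norm (c \<alpha>)" for \<alpha> :: "'n \<Rightarrow> nat"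
  have "(\<lambda>\<alpha>. s ^ sum \<alpha> UNIV *\<^sub>R c \<alpha>) summable_on UNIV"
    using g[OF vs] by (auto simp: summable_on_def power_sum)
  \<comment> \<open>summable real families are absolutely summable; so the sum of the absolute values of the
    components is a summable bound for the norm\<close>
  then have "(\<lambda>\<alpha>. (s ^ sum \<alpha> UNIV *\<^sub>R c \<alpha>) $ i) summable_on UNIV" for i
    by (rule summable_on_bounded_linear[OF bounded_linear_vec_nth])
  then have "(\<lambda>\<alpha>. norm ((s ^ sum \<alpha> UNIV *\<^sub>R c \<alpha>) $ i)) summable_on UNIV" for i
    by (subst (asm) summable_on_iff_abs_summable_on_real)
  then have "(\<lambda>\<alpha>. \<Sum>i\<in>J. norm ((s ^ sum \<alpha> UNIV *\<^sub>R c \<alpha>) $ i)) summable_on UNIV" for J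
    by (induction J rule: infinite_finite_induct) (simp_all add: summable_on_add)
  then have "G summable_on UNIV"
  proof (rule summable_on_comparison_test)
    fix \<alpha> :: "'n \<Rightarrow> nat"
    have "G \<alpha> = norm (s ^ sum \<alpha> UNIV *\<^sub>R c \<alpha>)" using s by (simp add: G_def)
    also have "\<dots> \<le> (\<Sum>i\<in>UNIV. norm ((s ^ sum \<alpha> UNIV *\<^sub>R c \<alpha>) $ i))"
      using norm_le_l1_cart[of "s ^ sum \<alpha> UNIV *\<^sub>R c \<alpha>"] by simp
    finally show "G \<alpha> \<le> \<dots>" .
  qed (use s in \<open>simp add: G_def\<close>)
  then have "G summable_on (UNIV - F)" by (rule summable_on_subset_banach) auto
  then obtain M where M: "(G has_sum M) (UNIV - F)" by (auto simp: summable_on_def)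
  have "M \<ge> 0" by (rule has_sum_nonneg[OF M]) (use s in \<open>simp add: G_def\<close>)
  have main: "norm (g h - c (\<lambda>_. 0) - (\<Sum>i\<in>UNIV. h $ i *\<^sub>R c (unit_index i))) \<le> M / s\<^sup>2 * (norm h)\<^sup>2"
    if "norm h \<le> s" for h
  proof -
    define T where "T \<alpha> = (\<Prod>i\<in>UNIV. (h $ i) ^ \<alpha> i) *\<^sub>R c \<alpha>" for \<alpha>
    have "(T has_sum g h) UNIV" unfolding T_def using g that \<open>s < r\<close> by auto
    moreover have "(T has_sum sum T F) F" by (rule has_sum_finite) (simp add: F_def)
    ultimately have rest: "(T has_sum (g h - sum T F)) (UNIV - F)" by (intro has_sum_Diff) auto
    have "(\<lambda>_. 0) \<notin> range (unit_index :: 'n \<Rightarrow> _)"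
      by (auto simp: unit_index_def fun_eq_iff) (metis zero_neq_one)
    then have "sum T F = T (\<lambda>_. 0) + (\<Sum>i\<in>UNIV. T (unit_index i))"
      by (simp add: F_def sum.reindex[OF inj_unit_index])
    moreover have "T (unit_index i) = h $ i *\<^sub>R c (unit_index i)" for i
      by (simp add: T_def unit_index_def if_distrib[of "\<lambda>k. _ ^ k"] cong: if_cong)
    moreover have "T (\<lambda>_. 0) = c (\<lambda>_. 0)" by (simp add: T_def)
    ultimately have low: "sum T F = c (\<lambda>_. 0) + (\<Sum>i\<in>UNIV. h $ i *\<^sub>R c (unit_index i))"
      by simp
    define t where "t = norm h / s"
    have t: "0 \<le> t" "t \<le> 1" "norm h = t * s" using that s by (auto simp: t_def)
    have "((\<lambda>\<alpha>. t\<^sup>2 * G \<alpha>) has_sum (t\<^sup>2 * M)) (UNIV - F)"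
      by (rule has_sum_cmult_right[OF M])
    with rest have "norm (g h - sum T F) \<le> t\<^sup>2 * M"
    proof (rule norm_infsum_le)
      fix \<alpha> assume "\<alpha> \<in> UNIV - F"
      then have ge: "2 \<le> sum \<alpha> UNIV" using sum_multiindex_ge_2 by (auto simp: F_def)
      have "norm (T \<alpha>) = (\<Prod>i\<in>UNIV. \<bar>h $ i\<bar> ^ \<alpha> i) * norm (c \<alpha>)"
        by (simp add: T_def abs_prod power_abs)
      also have "\<dots> \<le> (\<Prod>i\<in>UNIV. norm h ^ \<alpha> i) * norm (c \<alpha>)"
        by (intro mult_right_mono prod_mono) (auto intro: power_mono component_le_norm_cart)
      also have "\<dots> = t ^ sum \<alpha> UNIV * G \<alpha>"
        by (simp add: G_def t(3) power_sum power_mult_distrib prod.distrib)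
      also have "\<dots> \<le> t\<^sup>2 * G \<alpha>"
        using t ge s by (intro mult_right_mono power_decreasing) (auto simp: G_def)
      finally show "norm (T \<alpha>) \<le> t\<^sup>2 * G \<alpha>" .
    qed
    then show ?thesis by (simp add: low t_def power_divide diff_diff_eq mult.commute)
  qed
  show ?thesis by (rule that[OF s _ main]) (use \<open>M \<ge> 0\<close> in auto)
qed

lemma real_analytic_on_differentiable:
  fixes f :: "real ^ 'n \<Rightarrow> real ^ 'm"
  assumes "real_analytic_on f S" "a \<in> S"
  shows "f differentiable (at a)"
proof -
  obtain r c where "r > 0" and
    c: "\<forall>x\<in>ball a r. ((\<lambda>\<alpha>. (\<Prod>i\<in>UNIV. (x $ i - a $ i) ^ \<alpha> i) *\<^sub>R c \<alpha>) has_sum f x) UNIV"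
    using assms unfolding real_analytic_on_def by blast
  define L where "L h = (\<Sum>i\<in>UNIV. h $ i *\<^sub>R c (unit_index i))" for h
  have "((\<lambda>\<alpha>. (\<Prod>i\<in>UNIV. (h $ i) ^ \<alpha> i) *\<^sub>R c \<alpha>) has_sum f (a + h)) UNIV" if "h \<in> ball 0 r" for h
    using c[rule_format, of "a + h"] that by (simp add: dist_norm)
  from power_series_first_order[OF \<open>r > 0\<close> this] obtain s K where s: "s > 0" "0 \<le> K" and
    K: "\<And>h. norm h \<le> s \<Longrightarrow> norm (f (a + h) - c (\<lambda>_. 0) - L h) \<le> K * (norm h)\<^sup>2"
    unfolding L_def by blast
  have c0: "f a = c (\<lambda>_. 0)" using K[of 0] s by (simp add: L_def)
  have "bounded_linear L"
    unfolding L_def by (intro bounded_linear_sum bounded_linear_scaleR_const bounded_linear_vec_nth)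
  moreover have "(\<lambda>h. norm (f (a + h) - f a - L h) / norm h) \<midarrow>0\<rightarrow> 0"
  proof (rule Lim_null_comparison)
    show "(\<lambda>h :: real ^ 'n. K * norm h) \<midarrow>0\<rightarrow> 0" by (auto intro!: tendsto_eq_intros)
    show "\<forall>\<^sub>F h in at 0. norm (norm (f (a + h) - f a - L h) / norm h) \<le> K * norm h"
      unfolding eventually_at
    proof (intro exI conjI ballI impI)
      fix h :: "real ^ 'n" assume "h \<noteq> 0 \<and> dist h 0 < s"
      then show "norm (norm (f (a + h) - f a - L h) / norm h) \<le> K * norm h"
        using K[of h] by (simp add: c0 divide_le_eq power2_eq_square mult.assoc)
    qed (use s in auto)
  qed
  ultimately have "(f has_derivative L) (at a)" by (simp add: has_derivative_at)
  then show ?thesis by (rule differentiableI)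
qed

section \<open>Orbits of maps that decrease the norm\<close>

lemma has_derivative_funpow_at_fixpoint:
  assumes "(f has_derivative L) (at a)" "f a = a"
  shows "(f ^^ k has_derivative L ^^ k) (at a)"
proof (induction k)
  case (Suc k)
  have "(f ^^ k) a = a" using assms(2) by (induction k) auto
  with assms(1) have "(f has_derivative L) (at ((f ^^ k) a))" by simp
  from diff_chain_at[OF Suc this] show ?case by (simp only: funpow.simps)
qed (simp add: id_def)

lemma contraction_near_fixpoint_0:
  fixes g :: "'a :: real_normed_vector \<Rightarrow> 'a"
  assumes g: "(g has_derivative L) (at 0)" "g 0 = 0" and L: "onorm L < 1"
  obtains d where "d > 0" "\<And>x. x \<noteq> 0 \<Longrightarrow> norm x < d \<Longrightarrow> norm (g x) < norm x"
proof -
  have bl: "bounded_linear L" using g(1) by (rule has_derivative_bounded_linear)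
  obtain d where d: "d > 0"
    "\<And>x. norm x < d \<Longrightarrow> norm (g x - L x) \<le> (1 - onorm L) / 2 * norm x"
  proof -
    have "(1 - onorm L) / 2 > 0" using L by simp
    with g(1) have "\<exists>d>0. \<forall>x. norm (x - 0) < d \<longrightarrow>
        norm (g x - g 0 - L (x - 0)) \<le> (1 - onorm L) / 2 * norm (x - 0)"
      unfolding has_derivative_at_alt by blast
    then show ?thesis using that by (auto simp: g(2))
  qed
  have "norm (g x) < norm x" if "x \<noteq> 0" "norm x < d" for x
  proof -
    have "norm (g x) \<le> norm (L x) + norm (g x - L x)" by (rule norm_triangle_sub)
    also have "\<dots> \<le> onorm L * norm x + (1 - onorm L) / 2 * norm x"
      by (intro add_mono onorm bl d that)
    also have "\<dots> = (1 + onorm L) / 2 * norm x" by (simp add: field_simps)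
    also have "\<dots> < 1 * norm x" using L that by (intro mult_strict_right_mono) auto
    finally show ?thesis by simp
  qed
  with d(1) show ?thesis using that by blast
qed

text \<open>
  The norms along the orbit decrease to a limit \<open>L\<close>. At a limit point \<open>z\<close> of the orbit both \<open>z\<close> and \<open>g z\<close>
  have norm \<open>L\<close>, so \<open>g\<close> does not decrease the norm of \<open>z\<close>, and \<open>z = 0\<close>.
\<close>
lemma norm_decreasing_iterates_tendsto_0:
  fixes g :: "'a :: euclidean_space \<Rightarrow> 'a"
  assumes cont: "\<And>x. norm x \<le> norm y \<Longrightarrow> isCont g x" and "g 0 = 0"
    and decr: "\<And>x. x \<noteq> 0 \<Longrightarrow> norm x \<le> norm y \<Longrightarrow> norm (g x) < norm x"
  shows "(\<lambda>m. (g ^^ m) y) \<longlonglongrightarrow> 0"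
proof -
  have le: "norm (g x) \<le> norm x" if "norm x \<le> norm y" for x
    using decr[of x] that \<open>g 0 = 0\<close> by (cases "x = 0") auto
  have bound: "norm ((g ^^ m) y) \<le> norm y" for m
    by (induction m) (auto intro: order_trans le)
  have "decseq (\<lambda>m. norm ((g ^^ m) y))"
    by (rule decseq_SucI) (simp add: le bound)
  then obtain L where L: "(\<lambda>m. norm ((g ^^ m) y)) \<longlonglongrightarrow> L"
    using decseq_convergent[of _ 0] by (metis norm_ge_zero)
  obtain z r where z: "z \<in> cball 0 (norm y)" and r: "strict_mono r"
    and lim: "((\<lambda>m. (g ^^ m) y) \<circ> r) \<longlonglongrightarrow> z"
    using seq_compactE[OF compact_imp_seq_compact[OF compact_cball[of 0 "norm y"]],
        of "\<lambda>m. (g ^^ m) y"] bound by auto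
  have "norm z = L"
    using tendsto_norm[OF lim] LIMSEQ_subseq_LIMSEQ[OF L r]
    by (auto simp: o_def intro: LIMSEQ_unique)
  have "(\<lambda>m. g ((g ^^ r m) y)) \<longlonglongrightarrow> g z"
    using z lim by (intro isCont_tendsto_compose[OF cont]) (auto simp: o_def)
  from tendsto_norm[OF this] have "(\<lambda>m. norm ((g ^^ Suc (r m)) y)) \<longlonglongrightarrow> norm (g z)" by simp
  moreover have "(\<lambda>m. norm ((g ^^ Suc (r m)) y)) \<longlonglongrightarrow> L"
    using LIMSEQ_subseq_LIMSEQ[OF LIMSEQ_Suc[OF L] r] by (simp add: o_def)
  ultimately have "norm (g z) = L" by (rule LIMSEQ_unique)
  with \<open>norm z = L\<close> decr[of z] z have "z = 0" by auto
  with \<open>norm z = L\<close> L show ?thesis by (simp add: tendsto_norm_zero_iff)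
qed

text \<open>
  The orbit is the union of the \<open>q\<close> subsequences \<open>(f ^^ (j + q * m)) y\<close> with \<open>j < q\<close>. Each of them is the
  image under \<open>f ^^ j\<close> of one that tends to the fixed point \<open>a\<close>.
\<close>
lemma iterates_tendsto_if_power_iterates_tendsto:
  fixes f :: "'a :: metric_space \<Rightarrow> 'a"
  assumes "q > 0" and lim: "(\<lambda>m. ((f ^^ q) ^^ m) y) \<longlonglongrightarrow> a"
    and "isCont f a" "f a = a"
  shows "(\<lambda>k. (f ^^ k) y) \<longlonglongrightarrow> a"
proof (rule metric_LIMSEQ_I)
  fix e :: real assume "e > 0"
  have "(\<lambda>m. (f ^^ (j + q * m)) y) \<longlonglongrightarrow> a" for j
  proof (induction j)
    case 0
    then show ?case using lim by (simp add: funpow_mult)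
  next
    case (Suc j)
    with isCont_tendsto_compose[OF \<open>isCont f a\<close> Suc] \<open>f a = a\<close> show ?case by simp
  qed
  then have "\<forall>j. \<exists>N. \<forall>m\<ge>N. dist ((f ^^ (j + q * m)) y) a < e"
    using \<open>e > 0\<close> by (blast dest: metric_LIMSEQ_D)
  then obtain N where N: "\<And>j m. m \<ge> N j \<Longrightarrow> dist ((f ^^ (j + q * m)) y) a < e" by metis
  show "\<exists>no. \<forall>k\<ge>no. dist ((f ^^ k) y) a < e"
  proof (intro exI allI impI)
    fix k assume k: "k \<ge> q * Max (N ` {..<q})"
    have "N (k mod q) \<le> Max (N ` {..<q})" using \<open>q > 0\<close> by (intro Max_ge) auto
    also have "\<dots> \<le> k div q" using k \<open>q > 0\<close>
      by (metis div_le_mono nonzero_mult_div_cancel_left less_numeral_extra(3))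
    finally show "dist ((f ^^ k) y) a < e" using N[of "k mod q" "k div q"] by simp
  qed
qed

section \<open>The exponent and the radius\<close>

definition admissible_radius ::
  "(real ^ 'n \<Rightarrow> real ^ 'n) \<Rightarrow> (real ^ 'n) set \<Rightarrow> ereal \<Rightarrow> bool" where
  "admissible_radius f \<Omega> r \<longleftrightarrow> 0 < r \<and> eball0 r \<subseteq> \<Omega> \<and>
     (\<forall>p\<in>{p_tilde f..2 * p_tilde f - 1}. \<forall>x\<in>eball0 r - {0}. norm ((f ^^ p) x) < norm x)"

text \<open>
  Every point of the open ball whose radius is the supremum of the admissible radii lies in an
  admissible ball. Therefore the supremum is admissible, and is the greatest admissible radius.
\<close>
lemma admissible_radius_R_tilde:
  fixes f :: "real ^ 'n \<Rightarrow> real ^ 'n"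
  assumes "admissible_radius f \<Omega> r"
  shows "admissible_radius f \<Omega> (R_tilde f \<Omega>)"
proof -
  let ?S = "Sup (Collect (admissible_radius f \<Omega>))"
  have ball: "\<exists>r. admissible_radius f \<Omega> r \<and> x \<in> eball0 r" if "x \<in> eball0 ?S" for x :: "real ^ 'n"
    using that by (auto simp: eball0_def less_Sup_iff)
  have "r \<le> ?S" using assms by (intro Sup_upper) simp
  then have "0 < ?S" using assms by (auto simp: admissible_radius_def)
  with ball have "admissible_radius f \<Omega> ?S"
    unfolding admissible_radius_def[of f \<Omega> ?S]
  proof (intro conjI ballI subsetI)
    fix x :: "real ^ 'n" assume "x \<in> eball0 ?S"
    with ball show "x \<in> \<Omega>" unfolding admissible_radius_def by blast
  next
    fix k and x :: "real ^ 'n"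
    assume "k \<in> {p_tilde f..2 * p_tilde f - 1}" "x \<in> eball0 ?S - {0}"
    with ball show "norm ((f ^^ k) x) < norm x" unfolding admissible_radius_def by blast
  qed
  moreover from this have "R_tilde f \<Omega> = ?S"
    unfolding R_tilde_def admissible_radius_def[symmetric]
    by (rule Greatest_equality) (simp add: Sup_upper)
  ultimately show ?thesis by simp
qed

text \<open>
  The norms of the powers tend to 0, so the set of exponents whose least element is taken is
  not empty.
\<close>
lemma p_tilde_properties:
  assumes "mat_spectral_radius (jacobian f (at 0)) < 1"
  shows "1 \<le> p_tilde f" "\<And>k. k \<ge> p_tilde f \<Longrightarrow> mat_norm (mat_pow (jacobian f (at 0)) k) < 1"
proof -
  have "\<forall>\<^sub>F k in sequentially. mat_norm (mat_pow (jacobian f (at 0)) k) < 1"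
    by (rule order_tendstoD(2)[OF mat_norm_pow_tendsto_0[OF assms]]) simp
  then obtain N where "\<And>k. k \<ge> N \<Longrightarrow> mat_norm (mat_pow (jacobian f (at 0)) k) < 1"
    by (auto simp: eventually_sequentially)
  then have "1 \<le> Suc N \<and> (\<forall>k\<ge>Suc N. mat_norm (mat_pow (jacobian f (at 0)) k) < 1)" by auto
  then have "1 \<le> p_tilde f \<and> (\<forall>k\<ge>p_tilde f. mat_norm (mat_pow (jacobian f (at 0)) k) < 1)"
    unfolding p_tilde_def by (rule LeastI)
  then show "1 \<le> p_tilde f" "\<And>k. k \<ge> p_tilde f \<Longrightarrow> mat_norm (mat_pow (jacobian f (at 0)) k) < 1"
    by blast+
qed

text \<open>
  Near 0 the map \<open>f ^^ k\<close> is close to \<open>A ^ k\<close>, a contraction for \<open>k \<ge> p_tilde f\<close>. Only finitely many \<open>k\<close>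
  have to be considered, so a common radius exists.
\<close>
lemma admissible_radius_exists:
  fixes f :: "real ^ 'n \<Rightarrow> real ^ 'n"
  assumes "open \<Omega>" "0 \<in> \<Omega>" "f differentiable (at 0)" "f 0 = 0"
    and rho: "mat_spectral_radius (jacobian f (at 0)) < 1"
  obtains r where "admissible_radius f \<Omega> r"
proof -
  let ?P = "{p_tilde f..2 * p_tilde f - 1}"
  have f0: "(f ^^ k) 0 = 0" for k using \<open>f 0 = 0\<close> by (induction k) auto
  have "\<exists>d>0. \<forall>x. x \<noteq> 0 \<longrightarrow> norm x < d \<longrightarrow> norm ((f ^^ k) x) < norm x" if "k \<in> ?P" for k
  proof -
    have "(f has_derivative (*v) (jacobian f (at 0))) (at 0)"
      using \<open>f differentiable (at 0)\<close> jacobian_works by blast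
    then have "(f ^^ k has_derivative (*v) (jacobian f (at 0)) ^^ k) (at 0)"
      using \<open>f 0 = 0\<close> by (rule has_derivative_funpow_at_fixpoint)
    moreover have "onorm ((*v) (jacobian f (at 0)) ^^ k) < 1"
      using p_tilde_properties(2)[OF rho, of k] that
      by (simp add: mat_norm_def mat_pow_mult_vec[abs_def])
    ultimately show ?thesis using contraction_near_fixpoint_0 f0 by metis
  qed
  then obtain d where d: "\<And>k. k \<in> ?P \<Longrightarrow> d k > 0"
    "\<And>k x. k \<in> ?P \<Longrightarrow> x \<noteq> 0 \<Longrightarrow> norm x < d k \<Longrightarrow> norm ((f ^^ k) x) < norm x"
    by metis
  obtain e where e: "e > 0" "ball 0 e \<subseteq> \<Omega>" using assms(1,2) openE by blast
  define r where "r = Min (insert e (d ` ?P))"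
  have "r > 0" using e(1) d(1) by (auto simp: r_def)
  moreover have "r \<le> e" unfolding r_def by (intro Min_le) auto
  moreover have "r \<le> d k" if "k \<in> ?P" for k unfolding r_def using that by (intro Min_le) auto
  ultimately have "admissible_radius f \<Omega> (ereal r)"
    unfolding admissible_radius_def
  proof (intro conjI ballI subsetI)
    fix x :: "real ^ 'n" assume "x \<in> eball0 (ereal r)"
    with \<open>r \<le> e\<close> e(2) show "x \<in> \<Omega>" by (auto simp: eball0_def)
  next
    fix k and x :: "real ^ 'n"
    assume k: "k \<in> ?P" and "x \<in> eball0 (ereal r) - {0}"
    then have "x \<noteq> 0" "norm x < d k"
      using \<open>\<And>k. k \<in> ?P \<Longrightarrow> r \<le> d k\<close>[OF k] by (auto simp: eball0_def)
    with k show "norm ((f ^^ k) x) < norm x" by (rule d(2))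
  qed simp
  then show ?thesis by (rule that)
qed

lemma eball0_admissible_attracted:
  fixes f :: "real ^ 'n \<Rightarrow> real ^ 'n"
  assumes "admissible_radius f \<Omega> R" "1 \<le> p_tilde f" "f \<in> \<Omega> \<rightarrow> \<Omega>" "f 0 = 0"
    and cont: "\<And>x. x \<in> \<Omega> \<Longrightarrow> isCont f x" and y: "y \<in> eball0 R"
  shows "(\<lambda>k. (f ^^ k) y) \<longlonglongrightarrow> 0"
proof -
  let ?g = "f ^^ p_tilde f"
  have sub: "eball0 R \<subseteq> \<Omega>" using assms(1) by (simp add: admissible_radius_def)
  have inv: "(f ^^ k) x \<in> \<Omega>" if "x \<in> \<Omega>" for k x
    using that \<open>f \<in> \<Omega> \<rightarrow> \<Omega>\<close> by (induction k) auto
  have near: "x \<in> eball0 R" if "norm x \<le> norm y" for x :: "real ^ 'n"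
    using y le_less_trans[of "ereal (norm x)" "ereal (norm y)" R] that by (simp add: eball0_def)
  have "isCont (f ^^ k) x" if "x \<in> \<Omega>" for k x
  proof (induction k)
    case (Suc k)
    then show ?case using isCont_o2[OF Suc cont[OF inv[OF that]]] by (simp add: o_def)
  qed (simp add: id_def)
  moreover have "norm (?g x) < norm x" if "x \<noteq> 0" "norm x \<le> norm y" for x
    using assms(1,2) near[OF that(2)] that(1) by (auto simp: admissible_radius_def)
  moreover have "(f ^^ k) 0 = 0" for k using \<open>f 0 = 0\<close> by (induction k) auto
  ultimately have "(\<lambda>m. (?g ^^ m) y) \<longlonglongrightarrow> 0"
    using near sub by (intro norm_decreasing_iterates_tendsto_0) blast+
  moreover have "0 \<in> \<Omega>" using near[of 0] sub by auto
  ultimately show ?thesis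
    using assms(2,4) cont by (intro iterates_tendsto_if_power_iterates_tendsto) auto
qed

section \<open>Sublevel sets and attraction\<close>

lemma V_sum_less_imp_iterate_in_eball0:
  assumes "0 < R" "ereal (V_sum f p x) < ereal (real (p + 1)) * R\<^sup>2"
  obtains k where "(f ^^ k) x \<in> eball0 R"
proof (rule ccontr)
  assume "\<not> thesis"
  then have ge: "R \<le> ereal (norm ((f ^^ k) x))" for k
    using that by (fastforce simp: eball0_def not_less[symmetric])
  then obtain r where r: "R = ereal r" "r > 0"
    using \<open>0 < R\<close> by (cases R) auto
  then have "r\<^sup>2 \<le> (norm ((f ^^ k) x))\<^sup>2" for k
    using ge by (intro power_mono) auto
  then have "real (p + 1) * r\<^sup>2 \<le> V_sum f p x"
    unfolding V_sum_def using sum_bounded_below[of "{0..p}" "r\<^sup>2"] by auto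
  with assms(2) r show False by simp
qed

theorem theorem3p6:
  fixes f :: "real ^ 'n \<Rightarrow> real ^ 'n" and \<Omega> :: "(real ^ 'n) set" and p :: nat and c :: ereal
  assumes "open \<Omega>" and "connected \<Omega>" and "0 \<in> \<Omega>"
    and "f \<in> \<Omega> \<rightarrow> \<Omega>" and "real_analytic_on f \<Omega>" and "f 0 = 0"
    and "mat_spectral_radius (jacobian f (at 0)) < 1"
    and "p_tilde f \<le> p"
    and "0 < c" and "c \<le> ereal (real (p + 1)) * (R_tilde f \<Omega>)\<^sup>2"
  shows "N_set f \<Omega> p c \<subseteq> attraction_domain f \<Omega>"
proof
  fix x assume "x \<in> N_set f \<Omega> p c"
  then have x: "x \<in> \<Omega>" "ereal (V_sum f p x) < c" by (auto simp: N_set_def)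
  have diff: "f differentiable (at a)" if "a \<in> \<Omega>" for a
    using real_analytic_on_differentiable assms(5) that by blast
  then have cont: "isCont f a" if "a \<in> \<Omega>" for a
    using that differentiable_imp_continuous_within by blast
  obtain r where "admissible_radius f \<Omega> r"
    using admissible_radius_exists assms diff by blast
  then have adm: "admissible_radius f \<Omega> (R_tilde f \<Omega>)" by (rule admissible_radius_R_tilde)
  then have "0 < R_tilde f \<Omega>" by (simp add: admissible_radius_def)
  then obtain k where "(f ^^ k) x \<in> eball0 (R_tilde f \<Omega>)"
    using V_sum_less_imp_iterate_in_eball0 less_le_trans[OF x(2) assms(10)] by blast
  with adm have "(\<lambda>m. (f ^^ m) ((f ^^ k) x)) \<longlonglongrightarrow> 0"
    using p_tilde_properties(1) assms cont by (intro eball0_admissible_attracted) auto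
  then have "(\<lambda>m. (f ^^ (m + k)) x) \<longlonglongrightarrow> 0" by (simp add: funpow_add)
  then show "x \<in> attraction_domain f \<Omega>"
    using x(1) LIMSEQ_offset by (auto simp: attraction_domain_def)
qed

end
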